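(* Let $m,n$ be positive integers. Under the cost model described in the context, the time required to perform the majority-logic decoding algorithm (described in the context) for $C_m \wr S_n$ is $\mathrm{O}(mn\log m)$ if $m\geq n$, and $\mathrm{O}(n^2+mn\log n)$ if $m\leq n$.
   Context: Code: $C_m\wr S_n$ acts imprimitively on $n$ blocks of size $m$, the points being $\{1,\ldots,mn\}$ with blocks $\{1,\ldots,m\},\{m+1,\ldots,2m\},\ldots$. Its elements, written in list form, are the codewords (words of length $mn$). Such a list splits into $n$ consecutive segments of length $m$, each of which is a cyclic shift of one block listed in increasing order. If a list $L$ has a unique most frequently occurring element, it is denoted $\mathrm{majority}(L)$. Decoding algorithm. Input a received word $w=[w_1|w_2|\cdots|w_n]$, where $w_i=[w_{i1},\ldots,w_{im}]$ and each $w_{ij}\in\{1,\ldots,mn\}$. (1) For each $i,j$ compute $q_{ij},s_{ij}$ with $w_{ij}=mq_{ij}+s_{ij}$, $0\leq s_{ij}\leq m-1$. Set $b_{ij}=q_{ij}$ if $s_{ij}\neq 0$ and $b_{ij}=q_{ij}-1$ if $s_{ij}=0$, and let $c_{ij}\in\{0,\ldots,m-1\}$ with $c_{ij}\equiv s_{ij}-j \pmod m$. (2) For each $i$ compute $\widehat{b_i}=\mathrm{majority}[b_{i1},\ldots,b_{im}]$ and $\widehat{c_i}=\mathrm{majority}[c_{i1},\ldots,c_{im}]$ (these are assumed to exist). (3) Output $g=[g_1|\cdots|g_n]$ with $g_i=[g_{i1},\ldots,g_{im}]$, $g_{ij}=m\widehat{b_i}+t_{ij}$, where $t_{ij}\in\{1,\ldots,m\}$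 and $t_{ij}\equiv j+\widehat{c_i}\pmod m$. The majority of a list with symbols from a set of size $k$ is found by keeping an auxiliary list of $k$ counters, initially all zero. Each entry of the list is read in turn and the counter of that symbol is incremented, and then the position of the maximal counter is found. Cost model: integer arithmetic is done via a look-up table in constant time; comparing the sizes of two integers takes constant time; finding position $i$ in a list of length $k$ takes $\mathrm{O}(\log k)$ time; reading a symbol, initialising an entry, and incrementing an entry each take one unit of time. *)

theory Defs
  imports "HOL-Library.Landau_Symbols" "HOL-Library.Monad_Syntax"
begin

datatype 'a timed = Timed (result: 'a) (time: nat)

definition bind_timed :: "'a timed \<Rightarrow> ('a \<Rightarrow> 'b timed) \<Rightarrow> 'b timed" where
  "bind_timed a f = Timed (result (f (result a))) (time a + time (f (result a)))"

adhoc_overloading Monad_Syntax.bind \<rightleftharpoons> bind_timed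

definition return :: "'a \<Rightarrow> 'a timed" where
  "return x = Timed x 0"

text \<open>
  The three parameters are left open by the model: the constant cost of one arithmetic
  operation, the constant cost of one comparison, and the cost of finding position \<open>i < k\<close> in a
  list of length \<open>k\<close>, in the order \<open>find_time M k i\<close>. Reading, initialising and incrementing
  cost one unit each.
\<close>

record cost_model =
  arith_time :: nat
  compare_time :: nat
  find_time :: "nat \<Rightarrow> nat \<Rightarrow> nat"

definition logarithmic_find :: "cost_model \<Rightarrow> bool" where
  "logarithmic_find M \<longleftrightarrow>
    (\<lambda>k::nat. real (MAX i\<in>{..<k}. find_time M k i)) \<in> O(\<lambda>k. ln (real k))"

definition arith :: "cost_model \<Rightarrow> 'a \<Rightarrow> 'a timed" where
  "arith M x = Timed x (arith_time M)"

definition comparison :: "cost_model \<Rightarrow> bool \<Rightarrow> bool timed" where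
  "comparison M b = Timed b (compare_time M)"

definition find_position :: "cost_model \<Rightarrow> 'a list \<Rightarrow> nat \<Rightarrow> nat timed" where
  "find_position M xs i = Timed i (find_time M (length xs) i)"

definition read_symbol :: "'a \<Rightarrow> 'a timed" where
  "read_symbol x = Timed x 1"

definition init_entry :: "'a \<Rightarrow> 'a timed" where
  "init_entry x = Timed x 1"

definition increment_entry :: "nat list \<Rightarrow> nat \<Rightarrow> nat list timed" where
  "increment_entry xs i = Timed (xs[i := xs ! i + 1]) 1"

text \<open>Every round of a loop also pays for advancing the running index.\<close>

primrec loop :: "cost_model \<Rightarrow> (nat \<Rightarrow> 'a \<Rightarrow> 'b timed) \<Rightarrow> nat \<Rightarrow> 'a list \<Rightarrow> 'b list timed" where
  "loop M f i [] = return []"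
| "loop M f i (x # xs) = do {
     y \<leftarrow> f i x;
     i' \<leftarrow> arith M (i + 1);
     ys \<leftarrow> loop M f i' xs;
     return (y # ys)
   }"

definition most_frequent :: "'a list \<Rightarrow> 'a \<Rightarrow> bool" where
  "most_frequent L x \<longleftrightarrow> x \<in> set L \<and> (\<forall>y\<in>set L. count_list L y \<le> count_list L x)"

definition has_majority :: "'a list \<Rightarrow> bool" where
  "has_majority L \<longleftrightarrow> (\<exists>!x. most_frequent L x)"

definition majority :: "'a list \<Rightarrow> 'a" where
  "majority L = (THE x. most_frequent L x)"

text \<open>The symbols are \<open>{0..<k}\<close>, so that symbol \<open>x\<close> owns the counter in position \<open>x\<close>.\<close>

primrec count_symbols :: "cost_model \<Rightarrow> nat list \<Rightarrow> nat list \<Rightarrow> nat list timed" where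
  "count_symbols M [] ctrs = return ctrs"
| "count_symbols M (x # xs) ctrs = do {
     x \<leftarrow> read_symbol x;
     p \<leftarrow> find_position M ctrs x;
     ctrs' \<leftarrow> increment_entry ctrs p;
     count_symbols M xs ctrs'
   }"

text \<open>
  A scan of the counters from position \<open>i\<close> on; \<open>v\<close> is the largest counter so far and \<open>p\<close> its
  position.
\<close>

primrec max_position :: "cost_model \<Rightarrow> nat \<Rightarrow> nat \<Rightarrow> nat \<Rightarrow> nat list \<Rightarrow> nat timed" where
  "max_position M i p v [] = return p"
| "max_position M i p v (c # cs) = do {
     c \<leftarrow> read_symbol c;
     larger \<leftarrow> comparison M (v < c);
     i' \<leftarrow> arith M (i + 1);
     if larger then max_position M i' i c cs else max_position M i' p v cs
   }"

definition find_majority :: "cost_model \<Rightarrow> nat \<Rightarrow> nat list \<Rightarrow> nat timed" where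
  "find_majority M k L = do {
     ctrs \<leftarrow> loop M (\<lambda>_ _. init_entry 0) 0 (replicate k ());
     ctrs \<leftarrow> count_symbols M L ctrs;
     max_position M 0 0 0 ctrs
   }"

definition segments :: "nat \<Rightarrow> nat \<Rightarrow> 'a list \<Rightarrow> 'a list list" where
  "segments m n w = map (\<lambda>i. take m (drop (i * m) w)) [0..<n]"

text \<open>
  Segment \<open>i\<close> of a codeword is a cyclic shift of block \<open>p i\<close> in increasing order; blocks are
  numbered from 0, as in the decoding algorithm.
\<close>

definition codewords :: "nat \<Rightarrow> nat \<Rightarrow> nat list set" where
  "codewords m n = {concat (map (\<lambda>i. rotate (c i) [m * p i + 1..<m * p i + m + 1]) [0..<n]) | p c.
     bij_betw p {..<n} {..<n}}"

definition block_symbol :: "nat \<Rightarrow> nat \<Rightarrow> nat" where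
  "block_symbol m x = (if x mod m \<noteq> 0 then x div m else x div m - 1)"

definition shift_symbol :: "nat \<Rightarrow> nat \<Rightarrow> nat \<Rightarrow> nat" where
  "shift_symbol m j x = nat ((int (x mod m) - int j) mod int m)"

definition block_list :: "nat \<Rightarrow> nat list \<Rightarrow> nat list" where
  "block_list m u = map (block_symbol m) u"

definition shift_list :: "nat \<Rightarrow> nat list \<Rightarrow> nat list" where
  "shift_list m u = map2 (shift_symbol m) [1..<length u + 1] u"

text \<open>The second case makes the result the representative of \<open>j + c\<close> in \<open>{1..m}\<close>.\<close>

definition output_offset :: "nat \<Rightarrow> nat \<Rightarrow> nat \<Rightarrow> nat" where
  "output_offset m c j = (if (j + c) mod m \<noteq> 0 then (j + c) mod m else m)"

definition decode :: "nat \<Rightarrow> nat \<Rightarrow> nat list \<Rightarrow> nat list" where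
  "decode m n w = concat (map (\<lambda>u.
     map (\<lambda>j. m * majority (block_list m u) + output_offset m (majority (shift_list m u)) j)
       [1..<m + 1]) (segments m n w))"

definition received_words :: "nat \<Rightarrow> nat \<Rightarrow> nat list set" where
  "received_words m n = {w. length w = m * n \<and> set w \<subseteq> {1..m * n} \<and>
     (\<forall>u\<in>set (segments m n w). has_majority (block_list m u) \<and> has_majority (shift_list m u))}"

text \<open>
  The entries of the received word are met in the order in which
  they are stored, so each of them is just read. A pair stands for corresponding entries of two
  separate lists, and each of its components is initialised separately.
\<close>

definition analyse_symbol :: "cost_model \<Rightarrow> nat \<Rightarrow> nat \<Rightarrow> nat \<Rightarrow> (nat \<times> nat) timed" where
  "analyse_symbol M m j x = do {
     x \<leftarrow> read_symbol x;
     q \<leftarrow> arith M (x div m);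
     s \<leftarrow> arith M (x mod m);
     nonzero \<leftarrow> comparison M (s \<noteq> 0);
     b \<leftarrow> (if nonzero then return q else arith M (q - 1));
     d \<leftarrow> arith M (int s - int j);
     c \<leftarrow> arith M (nat (d mod int m));
     b \<leftarrow> init_entry b;
     c \<leftarrow> init_entry c;
     return (b, c)
   }"

definition step1 :: "cost_model \<Rightarrow> nat \<Rightarrow> nat \<Rightarrow> nat list \<Rightarrow> (nat \<times> nat) list list timed" where
  "step1 M m n w = loop M (\<lambda>_ u. loop M (analyse_symbol M m) 1 u) 1 (segments m n w)"

definition step2 :: "cost_model \<Rightarrow> nat \<Rightarrow> nat \<Rightarrow> (nat \<times> nat) list list \<Rightarrow> (nat \<times> nat) list timed" where
  "step2 M m n bcs = loop M (\<lambda>_ bc. do {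
     b \<leftarrow> find_majority M n (map fst bc);
     c \<leftarrow> find_majority M m (map snd bc);
     b \<leftarrow> init_entry b;
     c \<leftarrow> init_entry c;
     return (b, c)
   }) 1 bcs"

definition output_symbol :: "cost_model \<Rightarrow> nat \<Rightarrow> nat \<Rightarrow> nat \<Rightarrow> nat \<Rightarrow> nat timed" where
  "output_symbol M m b c j = do {
     b \<leftarrow> read_symbol b;
     c \<leftarrow> read_symbol c;
     e \<leftarrow> arith M (j + c);
     r \<leftarrow> arith M (e mod m);
     nonzero \<leftarrow> comparison M (r \<noteq> 0);
     t \<leftarrow> return (if nonzero then r else m);
     p \<leftarrow> arith M (m * b);
     g \<leftarrow> arith M (p + t);
     init_entry g
   }"

definition step3 :: "cost_model \<Rightarrow> nat \<Rightarrow> (nat \<times> nat) list \<Rightarrow> nat list list timed" where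
  "step3 M m hats =
     loop M (\<lambda>_ (b, c). loop M (\<lambda>j _. output_symbol M m b c j) 1 (replicate m ())) 1 hats"

definition timed_decode :: "cost_model \<Rightarrow> nat \<Rightarrow> nat \<Rightarrow> nat list \<Rightarrow> nat list timed" where
  "timed_decode M m n w = do {
     bcs \<leftarrow> step1 M m n w;
     hats \<leftarrow> step2 M m n bcs;
     gs \<leftarrow> step3 M m hats;
     return (concat gs)
   }"

text \<open>Worst case over all words that the algorithm accepts.\<close>

definition decoding_time :: "cost_model \<Rightarrow> nat \<Rightarrow> nat \<Rightarrow> nat" where
  "decoding_time M m n = (MAX w\<in>received_words m n. time (timed_decode M m n w))"

lemma result_bind [simp]: "result (bind_timed a f) = result (f (result a))"
  by (simp add: bind_timed_def)

lemma result_prims [simp]: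
  "result (return x) = x" "result (arith M x) = x" "result (comparison M b) = b"
  "result (find_position M xs i) = i" "result (read_symbol x) = x" "result (init_entry x) = x"
  "result (increment_entry xs i) = xs[i := xs ! i + 1]"
  by (simp_all add: return_def arith_def comparison_def find_position_def read_symbol_def
      init_entry_def increment_entry_def)

lemma result_loop [simp]:
  "result (loop M f i xs) = map2 (\<lambda>i x. result (f i x)) [i..<i + length xs] xs"
  by (induction xs arbitrary: i) (simp_all add: upt_conv_Cons del: upt_Suc)

lemma result_count_symbols:
  assumes "set xs \<subseteq> {..<length ctrs}"
  shows "length (result (count_symbols M xs ctrs)) = length ctrs"
    and "y < length ctrs \<Longrightarrow>
      result (count_symbols M xs ctrs) ! y = ctrs ! y + count_list xs y"
  using assms by (induction xs arbitrary: ctrs) (auto simp: nth_list_update)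

lemma result_max_position:
  assumes "q < length cs" "v < cs ! q" "\<forall>r<length cs. r \<noteq> q \<longrightarrow> cs ! r < cs ! q"
  shows "result (max_position M i p v cs) = i + q"
proof -
  have keep: "result (max_position M i p v cs) = p" if "\<forall>c\<in>set cs. c \<le> v" for i p v cs
    using that by (induction cs arbitrary: i) auto
  show ?thesis using assms
  proof (induction cs arbitrary: i p v q)
    case (Cons c cs)
    show ?case
    proof (cases q)
      case 0
      have "\<forall>d\<in>set cs. d \<le> c"
      proof
        fix d assume "d \<in> set cs"
        then obtain r where "r < length cs" "cs ! r = d" by (auto simp: in_set_conv_nth)
        thus "d \<le> c" using Cons.prems(3)[rule_format, of "Suc r"] 0 by simp
      qed
      thus ?thesis using Cons.prems 0 by (simp add: keep)
    next
      case (Suc q')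
      have *: "\<forall>r<length cs. r \<noteq> q' \<longrightarrow> cs ! r < cs ! q'"
      proof (intro allI impI)
        fix r assume "r < length cs" "r \<noteq> q'"
        thus "cs ! r < cs ! q'" using Cons.prems(3)[rule_format, of "Suc r"] Suc by simp
      qed
      have "c < cs ! q'" using Cons.prems(3)[rule_format, of 0] Suc by simp
      thus ?thesis using Cons.IH[OF _ _ *] Cons.prems Suc by simp
    qed
  qed simp
qed

lemma most_frequent_majority: "has_majority L \<Longrightarrow> most_frequent L (majority L)"
  unfolding has_majority_def majority_def by (rule theI')

lemma result_find_majority:
  assumes "has_majority L" "set L \<subseteq> {..<k}"
  shows "result (find_majority M k L) = majority L"
proof -
  define x where "x = majority L"
  have x: "most_frequent L x" using assms(1) most_frequent_majority x_def by blast
  have less: "count_list L y < count_list L x" if "y \<noteq> x" for y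
  proof (cases "y \<in> set L")
    case True
    show ?thesis
    proof (rule ccontr)
      assume "\<not> ?thesis"
      hence "most_frequent L y" using x True unfolding most_frequent_def by force
      thus False using x that assms(1) unfolding has_majority_def by blast
    qed
  next
    case False
    thus ?thesis using x by (simp add: most_frequent_def count_list_0_iff)
      (metis count_list_0_iff gr0I)
  qed
  define zs where "zs = map2 (\<lambda>_ _. 0::nat) [0..<k] (replicate k ())"
  have zs: "length zs = k" "\<And>y. y < k \<Longrightarrow> zs ! y = 0" by (simp_all add: zs_def)
  define cs where "cs = result (count_symbols M L zs)"
  have cs: "length cs = k" "\<And>y. y < k \<Longrightarrow> cs ! y = count_list L y"
    using result_count_symbols[where xs = L and ctrs = zs and M = M] assms(2) zs by (simp_all add: cs_def)
  have "x < k" using x assms(2) by (auto simp: most_frequent_def)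
  moreover have "0 < count_list L x"
    using x by (metis count_list_0_iff gr0I most_frequent_def)
  ultimately have "result (max_position M 0 0 0 cs) = 0 + x"
    by (intro result_max_position) (simp_all add: cs less)
  thus ?thesis by (simp add: find_majority_def cs_def zs_def x_def)
qed

lemma result_analyse_symbol [simp]:
  "result (analyse_symbol M m j x) = (block_symbol m x, shift_symbol m j x)"
  by (simp add: analyse_symbol_def block_symbol_def shift_symbol_def)

lemma result_output_symbol [simp]:
  "result (output_symbol M m b c j) = m * b + output_offset m c j"
  by (simp add: output_symbol_def output_offset_def)

lemma block_symbol_less:
  assumes "0 < m" "x \<in> {1..m * n}"
  shows "block_symbol m x < n"
proof (cases "x mod m = 0")
  case True
  then obtain q where "x = m * q" by auto
  thus ?thesis using assms True by (auto simp: block_symbol_def)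
next
  case False
  have "x \<noteq> m * n" using False by auto
  hence "x < n * m" using assms by (simp add: mult.commute)
  thus ?thesis using False by (simp add: block_symbol_def less_mult_imp_div_less)
qed

lemma shift_symbol_less: "0 < m \<Longrightarrow> shift_symbol m j x < m"
  by (simp add: shift_symbol_def nat_less_iff)

lemma map2_ignore_left: "map2 (\<lambda>_ x. f x) [i..<i + length xs] xs = map f xs"
  by (rule nth_equalityI) auto

lemma finite_received_words: "finite (received_words m n)"
  by (rule finite_subset[OF _ finite_lists_length_eq[of "{1..m * n}" "m * n"]])
    (auto simp: received_words_def)

lemma has_majority_replicate: "0 < k \<Longrightarrow> has_majority (replicate k x)"
  by (auto simp: has_majority_def most_frequent_def)

lemma segments_concat:
  assumes "\<forall>u\<in>set us. length u = m"
  shows "segments m (length us) (concat us) = us"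
  using assms
proof (induction us)
  case (Cons u us)
  have "[0..<length (u # us)] = 0 # map Suc [0..<length us]"
    by (simp add: map_Suc_upt upt_conv_Cons del: upt_Suc)
  thus ?case using Cons by (simp add: segments_def comp_def del: upt_Suc)
qed (simp add: segments_def)

lemma length_concat_segments: "\<forall>u\<in>set us. length u = m \<Longrightarrow> length (concat us) = m * length us"
  by (induction us) auto

lemma rotated_block:
  fixes m b c :: nat
  assumes "0 < m"
  defines "u \<equiv> rotate c [m * b + 1..<m * b + m + 1]"
  shows "block_list m u = replicate m b" and "shift_list m u = replicate m (c mod m)"
    and "map (\<lambda>j. m * b + output_offset m (c mod m) j) [1..<m + 1] = u"
proof -
  have len: "length u = m" by (simp add: u_def del: upt_Suc)
  have nth: "u ! j = m * b + ((c + j) mod m + 1)" if "j < m" for j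
    using that assms(1) by (simp add: u_def nth_rotate del: upt_Suc)
  have off: "output_offset m (c mod m) (1 + j) = (c + j) mod m + 1" for j
  proof -
    have "(1 + j + c mod m) mod m = (1 + j + c) mod m"
      by (rule mod_add_right_eq)
    also have "\<dots> = ((c + j) mod m + 1) mod m"
      by (simp add: mod_simps add.commute)
    finally have "(1 + j + c mod m) mod m = ((c + j) mod m + 1) mod m" .
    thus ?thesis
      using mod_less_divisor[OF assms(1), of "c + j"]
      by (cases "(c + j) mod m + 1 = m") (auto simp: output_offset_def)
  qed
  have sym: "block_symbol m (u ! j) = b \<and> shift_symbol m (1 + j) (u ! j) = c mod m"
    if "j < m" for j
  proof
    define r where "r = (c + j) mod m"
    have r: "r < m" using assms(1) by (simp add: r_def)
    have u: "u ! j = m * b + (r + 1)" using nth[OF that] by (simp add: r_def)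
    show "block_symbol m (u ! j) = b"
    proof (cases "r + 1 = m")
      case True
      hence "u ! j = Suc b * m" using u by simp
      thus ?thesis using assms(1) by (simp add: block_symbol_def)
    next
      case False
      hence "r + 1 < m" using r by simp
      hence "u ! j div m = b" "u ! j mod m = r + 1"
        unfolding u by (simp_all only: div_mult_self4 mod_mult_self4 less_imp_neq) simp_all
      thus ?thesis by (simp add: block_symbol_def)
    qed
    have "u ! j mod m = (c + j + 1) mod m"
      unfolding u r_def by (simp add: mod_simps)
    hence "int (u ! j mod m) = (int c + int j + 1) mod int m"
      by (simp add: zmod_int add_ac)
    hence "(int (u ! j mod m) - int (1 + j)) mod int m = int c mod int m"
      by (simp add: mod_simps)
    thus "shift_symbol m (1 + j) (u ! j) = c mod m"
      by (simp add: shift_symbol_def flip: zmod_int)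
  qed
  show "block_list m u = replicate m b" "shift_list m u = replicate m (c mod m)"
    using len sym
    by (auto intro!: nth_equalityI simp: block_list_def shift_list_def simp del: upt_Suc)
  show "map (\<lambda>j. m * b + output_offset m (c mod m) j) [1..<m + 1] = u"
    using len nth off by (auto intro!: nth_equalityI simp del: upt_Suc)
qed

theorem decode_codeword:
  assumes "0 < m" "w \<in> codewords m n"
  shows "w \<in> received_words m n" and "decode m n w = w"
proof -
  obtain p c where p: "bij_betw p {..<n} {..<n}" and
    w: "w = concat (map (\<lambda>i. rotate (c i) [m * p i + 1..<m * p i + m + 1]) [0..<n])"
    using assms(2) unfolding codewords_def by blast
  define us where "us = map (\<lambda>i. rotate (c i) [m * p i + 1..<m * p i + m + 1]) [0..<n]"
  have us: "w = concat us" "length us = n" "\<forall>u\<in>set us. length u = m"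
    by (auto simp: us_def w simp del: upt_Suc)
  have seg: "segments m n w = us" using segments_concat[OF us(3)] us by simp
  have maj: "has_majority (replicate m x)" "majority (replicate m x) = x" for x :: nat
    using assms(1) most_frequent_majority[OF has_majority_replicate[of m x]]
    by (simp_all add: has_majority_replicate most_frequent_def)
  have "set w \<subseteq> {1..m * n}"
  proof
    fix x assume "x \<in> set w"
    then obtain i where i: "i < n" "m * p i + 1 \<le> x" "x \<le> m * p i + m"
      by (auto simp: us us_def simp del: upt_Suc)
    have "p i < n" using p i(1) by (auto dest: bij_betwE)
    hence "m * Suc (p i) \<le> m * n" by (intro mult_le_mono2) simp
    thus "x \<in> {1..m * n}" using i by simp
  qed
  moreover have "length w = m * n" using length_concat_segments[OF us(3)] us by simp
  moreover have "has_majority (block_list m u) \<and> has_majority (shift_list m u)"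
    if u: "u \<in> set us" for u
  proof -
    obtain i where "u = rotate (c i) [m * p i + 1..<m * p i + m + 1]"
      using u unfolding us_def by auto
    thus ?thesis by (simp only: rotated_block(1,2)[OF assms(1)] maj simp_thms)
  qed
  ultimately show "w \<in> received_words m n"
    by (simp add: received_words_def seg)
  have "decode m n w = concat us"
    unfolding decode_def seg
    by (simp only: us_def map_map o_def rotated_block[OF assms(1)] maj)
  thus "decode m n w = w" by (simp add: us)
qed

theorem result_timed_decode:
  assumes "0 < m" "w \<in> received_words m n"
  shows "result (timed_decode M m n w) = decode m n w"
proof -
  let ?S = "segments m n w"
  let ?bc = "\<lambda>u. map2 (\<lambda>j x. (block_symbol m x, shift_symbol m j x)) [1..<1 + length u] u"
  let ?hat = "\<lambda>u. (majority (block_list m u), majority (shift_list m u))"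
  have r1: "result (step1 M m n w) = map ?bc ?S"
    unfolding step1_def result_loop result_analyse_symbol map2_ignore_left ..
  have hat: "result (find_majority M n (map fst (?bc u))) = majority (block_list m u)"
      "result (find_majority M m (map snd (?bc u))) = majority (shift_list m u)"
    if u: "u \<in> set ?S" for u
  proof -
    have fst: "map fst (?bc u) = block_list m u" and snd: "map snd (?bc u) = shift_list m u"
      by (auto intro!: nth_equalityI simp: block_list_def shift_list_def simp del: upt_Suc)
    have "set u \<subseteq> {1..m * n}"
      using u assms(2) by (auto simp: segments_def received_words_def
          dest!: in_set_takeD in_set_dropD)
    hence "set (block_list m u) \<subseteq> {..<n}"
      using block_symbol_less[OF assms(1)] by (auto simp: block_list_def)
    thus "result (find_majority M n (map fst (?bc u))) = majority (block_list m u)"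
      unfolding fst using u assms(2) by (intro result_find_majority) (auto simp: received_words_def)
    have "set (shift_list m u) \<subseteq> {..<m}"
      using shift_symbol_less[OF assms(1)] by (auto simp: shift_list_def)
    thus "result (find_majority M m (map snd (?bc u))) = majority (shift_list m u)"
      unfolding snd using u assms(2) by (intro result_find_majority) (auto simp: received_words_def)
  qed
  have r2: "result (step2 M m n (map ?bc ?S)) = map ?hat ?S"
    unfolding step2_def result_loop result_bind result_prims map2_ignore_left
    by (subst map_map) (intro map_cong refl, simp only: o_apply hat)
  have r3: "result (step3 M m hs) =
      map (\<lambda>(b, c). map (\<lambda>j. m * b + output_offset m c j) [1..<m + 1]) hs" for hs
    by (rule nth_equalityI)
      (auto simp: step3_def split_beta intro!: nth_equalityI simp del: upt_Suc)
  show ?thesis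
    unfolding timed_decode_def result_bind result_prims r1 r2 r3 decode_def by (simp add: comp_def)
qed

end

theory Submission
  imports Defs
begin

text \<open>
  Everything outside the majority computations is constant work per entry, over \<open>m * n\<close> entries.
  Each of the \<open>n\<close> segments needs two majorities of a list of length \<open>m\<close>: one with \<open>n\<close> counters
  for the block and one with \<open>m\<close> counters for the shift. Initialising and scanning \<open>k\<close> counters
  is linear in \<open>k\<close>, and counting takes one position search per entry. If \<open>F k\<close> is the worst
  search time in a list of length \<open>k\<close>, a segment therefore costs
  \<open>O(m + n + m * F n + m * F m)\<close>, and decoding costs \<open>O(n * (m + n) + m * n * (F n + F m))\<close>;
  this is \<open>decoding_time_le\<close>, with explicit constants. Here it matters that the symbols counted
  really are valid positions, since the search time is controlled only for those.

  The assumption gives \<open>F k = O(1 + ln k)\<close>, now uniformly over all \<open>k \<ge> 1\<close>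
  (\<open>bigo_ln_imp_uniform_bound\<close>). If \<open>m \<ge> n\<close>, then \<open>n * n\<close> and \<open>m * n\<close> are absorbed by
  \<open>m * n * ln m\<close>, as \<open>ln m \<ge> ln 2\<close> once the single pair \<open>(1, 1)\<close> is set aside. If \<open>m \<le> n\<close>,
  then \<open>m * n\<close> is absorbed by \<open>n * n\<close>.
\<close>

section \<open>Running times of the basic procedures\<close>

lemma time_bind [simp]: "time (bind_timed a f) = time a + time (f (result a))"
  by (simp add: bind_timed_def)

lemma time_prims [simp]:
  "time (return x) = 0" "time (arith M x) = arith_time M"
  "time (comparison M b) = compare_time M"
  "time (find_position M xs i) = find_time M (length xs) i"
  "time (read_symbol x) = 1" "time (init_entry x) = 1" "time (increment_entry xs i) = 1"
  by (simp_all add: return_def arith_def comparison_def find_position_def read_symbol_def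
      init_entry_def increment_entry_def)

lemma time_loop_le:
  assumes "\<And>j x. x \<in> set xs \<Longrightarrow> time (f j x) \<le> t"
  shows "time (loop M f i xs) \<le> length xs * (t + arith_time M)"
  using assms
proof (induction xs arbitrary: i)
  case (Cons x xs)
  have "time (f i x) \<le> t" using Cons.prems by simp
  moreover have "time (loop M f (i + 1) xs) \<le> length xs * (t + arith_time M)"
    using Cons by simp
  ultimately show ?case by simp
qed simp

lemma time_count_symbols_le:
  assumes "\<And>x. x \<in> set xs \<Longrightarrow> find_time M (length ctrs) x \<le> F"
  shows "time (count_symbols M xs ctrs) \<le> length xs * (2 + F)"
  using assms
proof (induction xs arbitrary: ctrs)
  case (Cons x xs)
  have "find_time M (length ctrs) x \<le> F" using Cons.prems by simp
  moreover have "time (count_symbols M xs (ctrs[x := ctrs ! x + 1])) \<le> length xs * (2 + F)"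
    by (rule Cons.IH) (use Cons.prems in simp)
  ultimately show ?case by simp
qed simp

lemma time_max_position:
  "time (max_position M i p v cs) = length cs * (1 + compare_time M + arith_time M)"
  by (induction cs arbitrary: i p v) simp_all

definition max_find_time :: "cost_model \<Rightarrow> nat \<Rightarrow> nat" where
  "max_find_time M k = (MAX i\<in>{..<k}. find_time M k i)"

lemma find_time_le_max: "i < k \<Longrightarrow> find_time M k i \<le> max_find_time M k"
  unfolding max_find_time_def by (rule Max_ge) auto

text \<open>
  One unit that pays for any of the constant-size pieces of work: handling one counter over its
  lifetime, analysing or writing one symbol, or the overhead of one round of a loop.
\<close>

definition unit_cost :: "cost_model \<Rightarrow> nat" where
  "unit_cost M = 3 + 6 * arith_time M + compare_time M"

text \<open>
  Each counter is initialised once and scanned once; each entry of the list costs a reading, a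
  search and an increment. As counting leaves the number of counters at \<open>k\<close>, every search takes
  place in a list of length \<open>k\<close>.
\<close>

lemma time_find_majority_le:
  assumes "set L \<subseteq> {..<k}"
  shows "time (find_majority M k L) \<le> k * unit_cost M + length L * (2 + max_find_time M k)"
proof -
  let ?zs = "result (loop M (\<lambda>_ _. init_entry (0::nat)) 0 (replicate k ()))"
  have len: "length ?zs = k" by simp
  have "length (result (count_symbols M L ?zs)) = k"
    using result_count_symbols(1)[of L ?zs M] assms len by simp
  moreover have "time (loop M (\<lambda>_ _. init_entry (0::nat)) 0 (replicate k ()))
      \<le> k * (1 + arith_time M)"
    using time_loop_le[of "replicate k ()" "\<lambda>_ _. init_entry (0::nat)" 1 M 0] by simp
  moreover have "time (count_symbols M L ?zs) \<le> length L * (2 + max_find_time M k)"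
    using assms len by (intro time_count_symbols_le) (auto intro: find_time_le_max)
  ultimately have "time (find_majority M k L) \<le> k * (1 + arith_time M)
      + length L * (2 + max_find_time M k) + k * (1 + compare_time M + arith_time M)"
    by (simp only: find_majority_def time_bind time_max_position)
  also have "k * (1 + arith_time M) + k * (1 + compare_time M + arith_time M) \<le> k * unit_cost M"
    unfolding add_mult_distrib2[symmetric] by (rule mult_le_mono2) (simp add: unit_cost_def)
  ultimately show ?thesis by simp
qed

section \<open>Running times of the three decoding steps\<close>

lemma time_analyse_symbol_le: "time (analyse_symbol M m j x) + arith_time M \<le> unit_cost M"
  by (simp add: analyse_symbol_def unit_cost_def)

lemma time_output_symbol_le: "time (output_symbol M m b c j) + arith_time M \<le> unit_cost M"
  by (simp add: output_symbol_def unit_cost_def)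

lemma length_segments [simp]: "length (segments m n w) = n"
  by (simp add: segments_def)

lemma length_segment:
  assumes "length w = m * n" "u \<in> set (segments m n w)"
  shows "length u = m"
proof -
  obtain i where i: "i < n" "u = take m (drop (i * m) w)"
    using assms(2) by (auto simp: segments_def)
  have "Suc i * m \<le> n * m" using i(1) by (intro mult_le_mono1) simp
  thus ?thesis using i assms(1) by (simp add: mult.commute)
qed

lemma set_segment_subset: "u \<in> set (segments m n w) \<Longrightarrow> set u \<subseteq> set w"
  by (auto simp: segments_def dest!: in_set_takeD in_set_dropD)

text \<open>
  The outer loop over the segments when the work inside a segment is one unit per entry; the
  extra \<open>1\<close> pays for advancing the outer index.
\<close>

lemma time_loop_segments_le:
  assumes inner: "\<And>j x. x \<in> set xs \<Longrightarrow> time (f j x) \<le> m * unit_cost M"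
  shows "time (loop M f i xs) \<le> length xs * ((m + 1) * unit_cost M)"
proof -
  have "time (loop M f i xs) \<le> length xs * (m * unit_cost M + arith_time M)"
    by (rule time_loop_le) (rule inner)
  also have "\<dots> \<le> length xs * ((m + 1) * unit_cost M)"
    by (intro mult_le_mono2) (simp add: unit_cost_def)
  finally show ?thesis .
qed

lemma time_loop_unit_cost_le:
  assumes "\<And>j x. x \<in> set xs \<Longrightarrow> time (f j x) + arith_time M \<le> unit_cost M"
  shows "time (loop M f i xs) \<le> length xs * unit_cost M"
proof -
  have "arith_time M \<le> unit_cost M" by (simp add: unit_cost_def)
  hence "time (loop M f i xs) \<le> length xs * ((unit_cost M - arith_time M) + arith_time M)"
    using assms by (intro time_loop_le) (simp add: le_diff_conv2)
  thus ?thesis using \<open>arith_time M \<le> unit_cost M\<close> by simp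
qed

lemma time_step1_le:
  assumes "length w = m * n"
  shows "time (step1 M m n w) \<le> n * ((m + 1) * unit_cost M)"
proof -
  have "time (loop M (analyse_symbol M m) 1 u) \<le> m * unit_cost M"
    if "u \<in> set (segments m n w)" for u
    using time_loop_unit_cost_le[of u "analyse_symbol M m" M 1] time_analyse_symbol_le
      length_segment[OF assms that] by simp
  thus ?thesis
    unfolding step1_def
    using time_loop_segments_le[of "segments m n w" "\<lambda>_ u. loop M (analyse_symbol M m) 1 u" m M 1]
    by simp
qed

text \<open>
  The lists handed to the majority computations consist of valid counter positions, so that the
  worst-case search times apply to them.
\<close>

lemma result_step1_entries:
  assumes "0 < m" "length w = m * n" "set w \<subseteq> {1..m * n}" "bc \<in> set (result (step1 M m n w))"
  shows "length bc = m" "set (map fst bc) \<subseteq> {..<n}" "set (map snd bc) \<subseteq> {..<m}"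
proof -
  obtain u where u: "u \<in> set (segments m n w)"
    and bc: "bc = map2 (\<lambda>j x. (block_symbol m x, shift_symbol m j x)) [1..<1 + length u] u"
    using assms(4) unfolding step1_def result_loop result_analyse_symbol map2_ignore_left by auto
  show "length bc = m" using length_segment[OF assms(2) u] by (simp add: bc)
  have "set u \<subseteq> {1..m * n}" using set_segment_subset[OF u] assms(3) by blast
  thus "set (map fst bc) \<subseteq> {..<n}"
    using block_symbol_less[OF assms(1)] by (auto simp: bc dest!: set_zip_rightD simp del: upt_Suc)
  show "set (map snd bc) \<subseteq> {..<m}"
    using shift_symbol_less[OF assms(1)] by (auto simp: bc simp del: upt_Suc)
qed

lemma time_step2_le:
  assumes "\<And>bc. bc \<in> set bcs \<Longrightarrow> length bc = m"
    and "\<And>bc. bc \<in> set bcs \<Longrightarrow> set (map fst bc) \<subseteq> {..<n}"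
    and "\<And>bc. bc \<in> set bcs \<Longrightarrow> set (map snd bc) \<subseteq> {..<m}"
  shows "time (step2 M m n bcs) \<le> length bcs *
    ((n + m + 1) * unit_cost M + m * (4 + max_find_time M n + max_find_time M m))"
proof -
  let ?t = "n * unit_cost M + m * (2 + max_find_time M n)
    + (m * unit_cost M + m * (2 + max_find_time M m)) + 2"
  have "time (step2 M m n bcs) \<le> length bcs * (?t + arith_time M)"
    unfolding step2_def
  proof (rule time_loop_le)
    fix j :: nat and bc assume bc: "bc \<in> set bcs"
    show "time (bind_timed (find_majority M n (map fst bc)) (\<lambda>b.
        bind_timed (find_majority M m (map snd bc)) (\<lambda>c.
        bind_timed (init_entry b) (\<lambda>b. bind_timed (init_entry c) (\<lambda>c. return (b, c)))))) \<le> ?t"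
      using time_find_majority_le[OF assms(2)[OF bc], of M]
        time_find_majority_le[OF assms(3)[OF bc], of M] assms(1)[OF bc]
      by simp
  qed
  also have "?t + arith_time M \<le>
      (n + m + 1) * unit_cost M + m * (4 + max_find_time M n + max_find_time M m)"
    by (simp add: algebra_simps) (simp add: unit_cost_def)
  finally show ?thesis by simp
qed

lemma time_step3_le: "time (step3 M m hats) \<le> length hats * ((m + 1) * unit_cost M)"
  unfolding step3_def
proof (rule time_loop_segments_le)
  fix j :: nat and x :: "nat \<times> nat"
  show "time (case x of (b, c) \<Rightarrow> loop M (\<lambda>j _. output_symbol M m b c j) 1 (replicate m ()))
      \<le> m * unit_cost M"
    using time_loop_unit_cost_le[of "replicate m ()" "\<lambda>j _. output_symbol M m (fst x) (snd x) j" M 1]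
      time_output_symbol_le
    by (simp add: case_prod_unfold)
qed

section \<open>Asymptotics\<close>

lemma time_timed_decode_le:
  assumes "1 \<le> m" "w \<in> received_words m n"
  shows "time (timed_decode M m n w) \<le>
    n * (n + 6 * m) * unit_cost M + m * n * (4 + max_find_time M n + max_find_time M m)"
proof -
  have w: "length w = m * n" "set w \<subseteq> {1..m * n}"
    using assms(2) by (auto simp: received_words_def)
  have m: "0 < m" using assms(1) by simp
  define bcs where "bcs = result (step1 M m n w)"
  define hats where "hats = result (step2 M m n bcs)"
  let ?F = "4 + max_find_time M n + max_find_time M m"
  have len: "length bcs = n" "length hats = n"
    by (simp_all add: bcs_def hats_def step1_def step2_def del: upt_Suc)
  have "time (timed_decode M m n w) =
      time (step1 M m n w) + time (step2 M m n bcs) + time (step3 M m hats)"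
    by (simp add: timed_decode_def bcs_def hats_def)
  also have "\<dots> \<le> n * ((m + 1) * unit_cost M) + n * ((n + m + 1) * unit_cost M + m * ?F)
      + n * ((m + 1) * unit_cost M)"
    using time_step1_le[OF w(1), of M] time_step3_le[of M m hats]
      time_step2_le[of bcs m n M] result_step1_entries[OF m w, of _ M] len
    unfolding bcs_def by (metis (no_types, lifting) add_le_mono)
  also have "\<dots> = n * (n + 3 * m + 3) * unit_cost M + m * n * ?F"
    by (simp add: algebra_simps)
  also have "\<dots> \<le> n * (n + 6 * m) * unit_cost M + m * n * ?F"
  proof -
    have "n + 3 * m + 3 \<le> n + 6 * m" using assms(1) by simp
    thus ?thesis by (intro add_right_mono mult_le_mono1 mult_le_mono2)
  qed
  finally show ?thesis .
qed

text \<open>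
  The maximum defining the decoding time ranges over a nonempty set because codewords can be
  received; for instance the identity, whose segments are the blocks in order.
\<close>

lemma decoding_time_le:
  assumes "1 \<le> m"
  shows "decoding_time M m n \<le>
    n * (n + 6 * m) * unit_cost M + m * n * (4 + max_find_time M n + max_find_time M m)"
proof -
  have "concat (map (\<lambda>i. rotate 0 [m * id i + 1..<m * id i + m + 1]) [0..<n]) \<in> codewords m n"
    unfolding codewords_def
    by (rule CollectI, rule exI[of _ id], rule exI[of _ "\<lambda>_. 0"]) simp
  hence "received_words m n \<noteq> {}"
    using decode_codeword(1)[of m _ n] assms by fastforce
  thus ?thesis
    unfolding decoding_time_def
    using time_timed_decode_le[OF assms] by (simp add: finite_received_words)
qed

text \<open>
  Adding \<open>1\<close> to the logarithm turns an eventual bound into one for all \<open>k \<ge> 1\<close>: it makes the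
  bound positive at \<open>k = 1\<close>, and the finitely many exceptional values go into the constant. The
  uniform form is needed because one of \<open>m\<close> and \<open>n\<close> may stay bounded while the other grows.
\<close>

lemma bigo_ln_imp_uniform_bound:
  fixes f :: "nat \<Rightarrow> real"
  assumes "f \<in> O(\<lambda>k. ln (real k))"
  obtains D where "0 \<le> D" "\<And>k. 1 \<le> k \<Longrightarrow> \<bar>f k\<bar> \<le> D * (1 + ln (real k))"
proof -
  obtain c where c: "c > 0" "eventually (\<lambda>k. norm (f k) \<le> c * norm (ln (real k))) at_top"
    using assms by (rule landau_o.bigE)
  then obtain N where N: "\<And>k. N \<le> k \<Longrightarrow> \<bar>f k\<bar> \<le> c * \<bar>ln (real k)\<bar>"
    by (auto simp: eventually_at_top_linorder)
  define S where "S = (\<Sum>k<N. \<bar>f k\<bar>)"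
  have S: "0 \<le> S" by (simp add: S_def sum_nonneg)
  have "\<bar>f k\<bar> \<le> (c + S) * (1 + ln (real k))" if k: "1 \<le> k" for k
  proof (cases "k < N")
    case True
    have "\<bar>f k\<bar> \<le> S"
      unfolding S_def using True by (intro member_le_sum) auto
    also have "\<dots> \<le> (c + S) * (1 + ln (real k))"
      using mult_mono[of S "c + S" 1 "1 + ln (real k)"] S c(1) k by simp
    finally show ?thesis .
  next
    case False
    hence "\<bar>f k\<bar> \<le> c * ln (real k)" using N[of k] k by simp
    also have "\<dots> \<le> (c + S) * (1 + ln (real k))"
      using S c(1) k by (intro mult_mono) simp_all
    finally show ?thesis .
  qed
  thus ?thesis using that[of "c + S"] S c(1) by simp
qed

theorem theorem6:
  fixes M :: cost_model
  assumes "logarithmic_find M"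
  shows "((\<lambda>(m, n). real (decoding_time M m n))
            \<in> O[inf cofinite (principal {(m, n). 1 \<le> m \<and> 1 \<le> n \<and> m \<ge> n})](\<lambda>(m, n).
              real m * real n * ln (real m)))
       \<and> ((\<lambda>(m, n). real (decoding_time M m n))
            \<in> O[inf cofinite (principal {(m, n). 1 \<le> m \<and> 1 \<le> n \<and> m \<le> n})](\<lambda>(m, n).
              (real n)\<^sup>2 + real m * real n * ln (real n)))"
proof -
  obtain D where D: "0 \<le> D"
    "\<And>k. 1 \<le> k \<Longrightarrow> real (max_find_time M k) \<le> D * (1 + ln (real k))"
    using assms unfolding logarithmic_find_def max_find_time_def[symmetric]
    by (rule bigo_ln_imp_uniform_bound) auto
  define U where "U = real (unit_cost M)"
  have U: "0 \<le> U" by (simp add: U_def)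
  \<comment> \<open>The constant in front of all terms without a logarithm, once \<open>n * n\<close> and \<open>m * n\<close> are merged.\<close>
  define A where "A = 7 * U + 4 + 2 * D"
  have A: "0 \<le> A" using U D(1) by (simp add: A_def)
  have bound: "real (decoding_time M m n) \<le> real n * real n * U
      + real m * real n * (6 * U + 4 + 2 * D + D * ln (real n) + D * ln (real m))"
    if mn: "1 \<le> m" "1 \<le> n" for m n
  proof -
    have "real (decoding_time M m n) \<le>
        real (n * (n + 6 * m) * unit_cost M + m * n * (4 + max_find_time M n + max_find_time M m))"
      using decoding_time_le[OF mn(1)] of_nat_mono by blast
    also have "\<dots> = real n * real n * U + real m * real n *
        (6 * U + 4 + real (max_find_time M n) + real (max_find_time M m))"
      by (simp add: U_def algebra_simps)
    also have "\<dots> \<le> real n * real n * U + real m * real n *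
        (6 * U + 4 + D * (1 + ln (real n)) + D * (1 + ln (real m)))"
      by (intro add_mono mult_left_mono D(2) mn order.refl) simp_all
    finally show ?thesis by (simp add: algebra_simps)
  qed
  have wide: "real (decoding_time M m n) \<le> (A / ln 2 + 2 * D) * (real m * real n * ln (real m))"
    if mn: "1 \<le> m" "1 \<le> n" "n \<le> m" "2 \<le> m" for m n
  proof -
    have "real n * real n * U \<le> real m * real n * U"
      using mn U by (intro mult_right_mono) simp_all
    moreover have "D * ln (real n) \<le> D * ln (real m)"
      using mn D(1) by (intro mult_left_mono) simp_all
    hence "real m * real n * (6 * U + 4 + 2 * D + D * ln (real n) + D * ln (real m))
        \<le> real m * real n * (6 * U + 4 + 2 * D + D * ln (real m) + D * ln (real m))"
      by (intro mult_left_mono) simp_all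
    ultimately have "real (decoding_time M m n) \<le> real m * real n * (A + 2 * D * ln (real m))"
      using bound[OF mn(1,2)] by (simp add: A_def algebra_simps)
    also have "A \<le> A / ln 2 * ln (real m)"
    proof -
      have "A * ln 2 \<le> A * ln (real m)"
        using A mn(4) by (intro mult_left_mono) simp_all
      thus ?thesis by (simp add: field_simps)
    qed
    hence "real m * real n * (A + 2 * D * ln (real m))
        \<le> real m * real n * (A / ln 2 * ln (real m) + 2 * D * ln (real m))"
      by (intro mult_left_mono) simp_all
    finally show ?thesis by (simp add: algebra_simps)
  qed
  have tall: "real (decoding_time M m n) \<le>
      (A + 2 * D) * ((real n)\<^sup>2 + real m * real n * ln (real n))"
    if mn: "1 \<le> m" "1 \<le> n" "m \<le> n" for m n
  proof -
    let ?l = "real m * real n * ln (real n)"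
    have l: "0 \<le> ?l" using mn by simp
    have "D * ln (real m) \<le> D * ln (real n)"
      using mn D(1) by (intro mult_left_mono) simp_all
    hence "real m * real n * (6 * U + 4 + 2 * D + D * ln (real n) + D * ln (real m))
        \<le> real m * real n * (6 * U + 4 + 2 * D + D * ln (real n) + D * ln (real n))"
      by (intro mult_left_mono) simp_all
    moreover have "real m * real n * (6 * U + 4 + 2 * D) \<le> real n * real n * (6 * U + 4 + 2 * D)"
      using mn U D(1) by (intro mult_right_mono) simp_all
    ultimately have "real (decoding_time M m n) \<le> A * (real n)\<^sup>2 + 2 * D * ?l"
      using bound[OF mn(1,2)] by (simp add: A_def algebra_simps power2_eq_square)
    also have "\<dots> \<le> (A + 2 * D) * (real n)\<^sup>2 + (A + 2 * D) * ?l"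
      using A D(1) l by (intro add_mono mult_right_mono) simp_all
    finally show ?thesis by (simp add: algebra_simps)
  qed
  show ?thesis
  proof
    show "(\<lambda>(m, n). real (decoding_time M m n))
        \<in> O[inf cofinite (principal {(m, n). 1 \<le> m \<and> 1 \<le> n \<and> m \<ge> n})](\<lambda>(m, n).
          real m * real n * ln (real m))"
    proof (rule bigoI[where c = "A / ln 2 + 2 * D"])
      have off_11: "norm (real (decoding_time M m n)) \<le>
          (A / ln 2 + 2 * D) * norm (real m * real n * ln (real m))"
        if mn: "(m, n) \<noteq> (1, 1)" "1 \<le> m" "1 \<le> n" "n \<le> m" for m n
      proof -
        have "2 \<le> m" using mn by (cases "m = 1") auto
        thus ?thesis using wide[OF mn(2-4)] mn(2) by simp
      qed
      \<comment> \<open>At \<open>(1, 1)\<close> the bound vanishes, and every other pair with \<open>n \<le> m\<close> has \<open>2 \<le> m\<close>.\<close>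
      have "eventually (\<lambda>x. x \<noteq> (1, 1)) (cofinite :: (nat \<times> nat) filter)"
        by (simp add: eventually_cofinite)
      thus "eventually (\<lambda>x. norm (case x of (m, n) \<Rightarrow> real (decoding_time M m n)) \<le>
          (A / ln 2 + 2 * D) * norm (case x of (m, n) \<Rightarrow> real m * real n * ln (real m)))
          (inf cofinite (principal {(m, n). 1 \<le> m \<and> 1 \<le> n \<and> m \<ge> n}))"
        unfolding eventually_inf_principal
      proof (rule eventually_mono)
        fix x :: "nat \<times> nat" assume "x \<noteq> (1, 1)"
        thus "x \<in> {(m, n). 1 \<le> m \<and> 1 \<le> n \<and> m \<ge> n} \<longrightarrow>
            norm (case x of (m, n) \<Rightarrow> real (decoding_time M m n)) \<le>
            (A / ln 2 + 2 * D) * norm (case x of (m, n) \<Rightarrow> real m * real n * ln (real m))"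
          using off_11[of "fst x" "snd x"] by (simp add: case_prod_unfold del: real_norm_def)
      qed
    qed
    show "(\<lambda>(m, n). real (decoding_time M m n))
        \<in> O[inf cofinite (principal {(m, n). 1 \<le> m \<and> 1 \<le> n \<and> m \<le> n})](\<lambda>(m, n).
          (real n)\<^sup>2 + real m * real n * ln (real n))"
    proof (rule bigoI[where c = "A + 2 * D"])
      have "norm (real (decoding_time M m n)) \<le>
          (A + 2 * D) * norm ((real n)\<^sup>2 + real m * real n * ln (real n))"
        if mn: "1 \<le> m" "1 \<le> n" "m \<le> n" for m n
      proof -
        have "0 \<le> (real n)\<^sup>2 + real m * real n * ln (real n)" using mn by simp
        thus ?thesis using tall[OF mn] by simp
      qed
      thus "eventually (\<lambda>x. norm (case x of (m, n) \<Rightarrow> real (decoding_time M m n)) \<le>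
          (A + 2 * D) * norm (case x of (m, n) \<Rightarrow> (real n)\<^sup>2 + real m * real n * ln (real n)))
          (inf cofinite (principal {(m, n). 1 \<le> m \<and> 1 \<le> n \<and> m \<le> n}))"
        unfolding eventually_inf_principal
        by (intro always_eventually allI) (simp add: case_prod_unfold del: real_norm_def)
    qed
  qed
qed

end
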